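(* Let $\mathbb{X}$ and $\mathbb{Y}$ be Hausdorff topological spaces and $\Phi:\mathbb{X}\to 2^{\mathbb{Y}}\setminus\{\emptyset\}$ a set-valued mapping. If $\mathbb{X}$ is compactly generated, then a function $u:\mathbb{X}\times\mathbb{Y}\to\mathbb{R}\cup\{\pm\infty\}$ is $\mathbb{K}\mathbb{N}$-inf-compact on $\mathrm{Gr}_{\mathbb{X}}(\Phi)$ if and only if it is $\mathbb{K}$-inf-compact on $\mathrm{Gr}_{\mathbb{X}}(\Phi)$.
   Context: A topological space $\mathbb{X}$ is compactly generated if a set $A\subseteq\mathbb{X}$ is closed in $\mathbb{X}$ whenever $A\cap K$ is closed in $K$ for every nonempty compact $K\subseteq\mathbb{X}$. For $Z\subseteq\mathbb{X}$, $\mathrm{Gr}_Z(\Phi)=\{(x,y)\in Z\times\mathbb{Y}: y\in\Phi(x)\}$. For an extended-real-valued function $f$ on a nonempty subset $U$ of a topological space and $\lambda\in\mathbb{R}$, let $\mathcal{D}_f(\lambda;U)=\{y\in U: f(y)\le\lambda\}$. The function $f$ is lower semi-continuous on $U$ if all sets $\mathcal{D}_f(\lambda;U)$, $\lambda\in\mathbb{R}$, are closed (in the subspace topology of $U$), and inf-compact on $U$ if all these sets are compact. $u$ is $\mathbb{K}$-inf-compact on $\mathrm{Gr}_{\mathbb{X}}(\Phi)$ if for every nonempty compact $K\subseteq\mathbb{X}$ it is inf-compact on $\mathrm{Gr}_K(\Phi)$. $u$ is $\mathbb{K}\mathbb{N}$-inf-compact on $\mathrm{Gr}_{\mathbb{X}}(\Phi)$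 if: (i) $u$ is lower semi-continuous on $\mathrm{Gr}_{\mathbb{X}}(\Phi)$; and (ii) for any net $\{x_i\}_{i\in I}$ in $\mathbb{X}$ converging to some $x\in\mathbb{X}$, any net $\{y_i\}_{i\in I}$ (indexed by the same directed set $I$) with $y_i\in\Phi(x_i)$ for all $i\in I$ and such that the set $\{u(x_i,y_i): i\in I\}$ is bounded above by a real number has an accumulation point (i.e., a limit of some subnet) $y\in\Phi(x)$. *)

theory Defs
  imports "HOL-Analysis.Analysis"
begin

lemma k_space_euclidean_iff:
  "k_space (euclidean :: 'a::topological_space topology) \<longleftrightarrow>
     (\<forall>A::'a set. (\<forall>K. compact K \<and> K \<noteq> {} \<longrightarrow> closedin (top_of_set K) (A \<inter> K)) \<longrightarrow> closed A)"
proof -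
  have "(\<forall>K. compact K \<longrightarrow> closedin (top_of_set K) (K \<inter> A)) \<longleftrightarrow>
        (\<forall>K. compact K \<and> K \<noteq> {} \<longrightarrow> closedin (top_of_set K) (A \<inter> K))" for A :: "'a set"
    by (metis Int_commute Int_empty_left closedin_empty)
  then show ?thesis
    by (simp add: k_space)
qed

abbreviation Gr :: "'x set \<Rightarrow> ('x \<Rightarrow> 'y set) \<Rightarrow> ('x \<times> 'y) set"
  where "Gr Z \<Phi> \<equiv> Sigma Z \<Phi>"

definition sublevel_set :: "('a \<Rightarrow> ereal) \<Rightarrow> real \<Rightarrow> 'a set \<Rightarrow> 'a set"
  where "sublevel_set f c U = {y \<in> U. f y \<le> ereal c}"

definition lower_semicontinuous_on :: "'a::topological_space set \<Rightarrow> ('a \<Rightarrow> ereal) \<Rightarrow> bool"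
  where "lower_semicontinuous_on U f \<longleftrightarrow> (\<forall>c. closedin (top_of_set U) (sublevel_set f c U))"

definition inf_compact_on :: "'a::topological_space set \<Rightarrow> ('a \<Rightarrow> ereal) \<Rightarrow> bool"
  where "inf_compact_on U f \<longleftrightarrow> (\<forall>c. compact (sublevel_set f c U))"

definition K_inf_compact ::
    "('x::topological_space \<Rightarrow> 'y::topological_space set) \<Rightarrow> ('x \<times> 'y \<Rightarrow> ereal) \<Rightarrow> bool"
  where "K_inf_compact \<Phi> u \<longleftrightarrow> (\<forall>K. compact K \<and> K \<noteq> {} \<longrightarrow> inf_compact_on (Gr K \<Phi>) u)"

definition directed_set :: "'i set \<Rightarrow> ('i \<Rightarrow> 'i \<Rightarrow> bool) \<Rightarrow> bool"
  where "directed_set I le \<longleftrightarrow> I \<noteq> {} \<and> reflp_on I le \<and> transp_on I le \<and>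
           (\<forall>i\<in>I. \<forall>j\<in>I. \<exists>k\<in>I. le i k \<and> le j k)"

definition net_converges ::
    "'i set \<Rightarrow> ('i \<Rightarrow> 'i \<Rightarrow> bool) \<Rightarrow> ('i \<Rightarrow> 'a::topological_space) \<Rightarrow> 'a \<Rightarrow> bool"
  where "net_converges I le x l \<longleftrightarrow>
           (\<forall>U. open U \<and> l \<in> U \<longrightarrow> (\<exists>i\<in>I. \<forall>j\<in>I. le i j \<longrightarrow> x j \<in> U))"

text \<open>A subnet of a net with index set \<open>I\<close> is its composition with a map \<open>h\<close> into \<open>I\<close> from
  another directed set \<open>J\<close> that is eventually above every \<open>i\<close> in \<open>I\<close> (Kelley).\<close>

definition subnet_map ::
    "'i set \<Rightarrow> ('i \<Rightarrow> 'i \<Rightarrow> bool) \<Rightarrow> 'j set \<Rightarrow> ('j \<Rightarrow> 'j \<Rightarrow> bool) \<Rightarrow> ('j \<Rightarrow> 'i) \<Rightarrow> bool"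
  where "subnet_map I le J le' h \<longleftrightarrow> directed_set J le' \<and> h ` J \<subseteq> I \<and>
           (\<forall>i\<in>I. \<exists>j\<in>J. \<forall>k\<in>J. le' j k \<longrightarrow> le i (h k))"

text \<open>HOL cannot quantify over index types inside a formula, so the index sets of the subnets are
  taken in one fixed type. No subnet limit is lost: see \<open>net_accumulation_pointI\<close> below.\<close>

definition net_accumulation_point ::
    "'i set \<Rightarrow> ('i \<Rightarrow> 'i \<Rightarrow> bool) \<Rightarrow> ('i \<Rightarrow> 'a::topological_space) \<Rightarrow> 'a \<Rightarrow> bool"
  where "net_accumulation_point I le y l \<longleftrightarrow>
           (\<exists>(J :: ('i \<times> 'a set) set) le' h.
              subnet_map I le J le' h \<and> net_converges J le' (y \<circ> h) l)"

lemma subnet_limit_imp_frequently: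
  assumes "subnet_map I le J le' h" "net_converges J le' (y \<circ> h) l"
    and "open U" "l \<in> U" "i \<in> I"
  shows "\<exists>j\<in>I. le i j \<and> y j \<in> U"
proof -
  obtain a where a: "a \<in> J" "\<And>k. k \<in> J \<Longrightarrow> le' a k \<Longrightarrow> le i (h k)"
    using assms unfolding subnet_map_def by blast
  obtain b where b: "b \<in> J" "\<And>k. k \<in> J \<Longrightarrow> le' b k \<Longrightarrow> y (h k) \<in> U"
    using assms unfolding net_converges_def by auto
  obtain k where k: "k \<in> J" "le' a k" "le' b k"
    using assms(1) a(1) b(1) unfolding subnet_map_def directed_set_def by blast
  then have "h k \<in> I"
    using assms(1) by (auto simp: subnet_map_def)
  with a b k show ?thesis by blast
qed

lemma net_accumulation_point_iff:
  fixes I :: "'i set" and y :: "'i \<Rightarrow> 'a::topological_space"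
  assumes I: "directed_set I le"
  shows "net_accumulation_point I le y l \<longleftrightarrow>
           (\<forall>U. open U \<and> l \<in> U \<longrightarrow> (\<forall>i\<in>I. \<exists>j\<in>I. le i j \<and> y j \<in> U))"
proof
  assume "net_accumulation_point I le y l"
  then show "\<forall>U. open U \<and> l \<in> U \<longrightarrow> (\<forall>i\<in>I. \<exists>j\<in>I. le i j \<and> y j \<in> U)"
    unfolding net_accumulation_point_def by (meson subnet_limit_imp_frequently)
next
  assume *: "\<forall>U. open U \<and> l \<in> U \<longrightarrow> (\<forall>i\<in>I. \<exists>j\<in>I. le i j \<and> y j \<in> U)"
  define J where "J = {(i, U). i \<in> I \<and> open U \<and> l \<in> U \<and> y i \<in> U}"
  define le' :: "'i \<times> 'a set \<Rightarrow> 'i \<times> 'a set \<Rightarrow> bool"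
    where "le' = (\<lambda>p q. le (fst p) (fst q) \<and> snd q \<subseteq> snd p)"
  have refl: "\<And>i. i \<in> I \<Longrightarrow> le i i"
    using I by (simp add: directed_set_def reflp_on_def)
  have trans: "\<And>i j k. i \<in> I \<Longrightarrow> j \<in> I \<Longrightarrow> k \<in> I \<Longrightarrow> le i j \<Longrightarrow> le j k \<Longrightarrow> le i k"
    using I unfolding directed_set_def by (meson transp_onD)
  obtain i0 where i0: "i0 \<in> I"
    using I by (auto simp: directed_set_def)
  have "directed_set J le'"
    unfolding directed_set_def
  proof (intro conjI ballI)
    show "J \<noteq> {}" using i0 by (auto simp: J_def)
    show "reflp_on J le'" by (auto simp: reflp_on_def J_def le'_def refl)
    show "transp_on J le'"
      by (rule transp_onI) (auto simp: J_def le'_def intro: trans)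
  next
    fix p q assume pq: "p \<in> J" "q \<in> J"
    obtain i U j V where eq: "p = (i, U)" "q = (j, V)" by fastforce
    with pq have ij: "i \<in> I" "j \<in> I" and UV: "open (U \<inter> V)" "l \<in> U \<inter> V"
      by (auto simp: J_def)
    obtain k where k: "k \<in> I" "le i k" "le j k"
      using I ij by (auto simp: directed_set_def)
    obtain m where m: "m \<in> I" "le k m" "y m \<in> U \<inter> V"
      using * UV k(1) by blast
    have "(m, U \<inter> V) \<in> J" using m UV by (simp add: J_def)
    moreover have "le i m" "le j m" using trans ij k m by blast+
    ultimately show "\<exists>r\<in>J. le' p r \<and> le' q r"
      by (intro bexI[of _ "(m, U \<inter> V)"]) (auto simp: le'_def eq)
  qed
  moreover have "\<exists>j\<in>J. \<forall>k\<in>J. le' j k \<longrightarrow> le i (fst k)" if "i \<in> I" for i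
    using that by (intro bexI[of _ "(i, UNIV)"]) (auto simp: J_def le'_def)
  ultimately have "subnet_map I le J le' fst"
    by (auto simp: subnet_map_def J_def)
  moreover have "net_converges J le' (y \<circ> fst) l"
    unfolding net_converges_def
  proof (intro allI impI)
    fix U assume U: "open U \<and> l \<in> U"
    then obtain j where "j \<in> I" "y j \<in> U" using * i0 by blast
    with U show "\<exists>i\<in>J. \<forall>k\<in>J. le' i k \<longrightarrow> (y \<circ> fst) k \<in> U"
      by (intro bexI[of _ "(j, U)"]) (auto simp: J_def le'_def)
  qed
  ultimately show "net_accumulation_point I le y l"
    unfolding net_accumulation_point_def by blast
qed

lemma net_accumulation_pointI:
  fixes J :: "'j set"
  assumes "directed_set I le" "subnet_map I le J le' h" "net_converges J le' (y \<circ> h) l"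
  shows "net_accumulation_point I le y l"
  unfolding net_accumulation_point_iff[OF assms(1)]
  using subnet_limit_imp_frequently[OF assms(2,3)] by blast

text \<open>The net condition, for nets whose index sets lie in the type \<open>'i\<close>.\<close>

definition KN_net_condition ::
    "'i itself \<Rightarrow> ('x::topological_space \<Rightarrow> 'y::topological_space set) \<Rightarrow> ('x \<times> 'y \<Rightarrow> ereal) \<Rightarrow> bool"
  where "KN_net_condition _ \<Phi> u \<longleftrightarrow>
    (\<forall>(I :: 'i set) le x y l.
       directed_set I le \<and> net_converges I le x l \<and> (\<forall>i\<in>I. y i \<in> \<Phi> (x i)) \<and>
       (\<exists>c::real. \<forall>i\<in>I. u (x i, y i) \<le> ereal c)
       \<longrightarrow> (\<exists>z\<in>\<Phi> l. net_accumulation_point I le y z))"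

text \<open>The index type fixed here is large enough to give the net condition for all index types:
  see \<open>KN_inf_compact_net_condition\<close> below.\<close>

definition KN_inf_compact ::
    "('x::topological_space \<Rightarrow> 'y::topological_space set) \<Rightarrow> ('x \<times> 'y \<Rightarrow> ereal) \<Rightarrow> bool"
  where "KN_inf_compact \<Phi> u \<longleftrightarrow>
    lower_semicontinuous_on (Gr UNIV \<Phi>) u \<and>
    KN_net_condition TYPE(('x \<times> 'y) set \<times> ('x \<times> 'y)) \<Phi> u"

lemma KN_inf_compact_net_condition:
  fixes \<Phi> :: "'x::topological_space \<Rightarrow> 'y::topological_space set"
  assumes "KN_inf_compact \<Phi> u"
  shows "KN_net_condition TYPE('i) \<Phi> u"
  unfolding KN_net_condition_def
proof (intro allI impI)
  fix I :: "'i set" and le x y l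
  assume A: "directed_set I le \<and> net_converges I le x l \<and> (\<forall>i\<in>I. y i \<in> \<Phi> (x i)) \<and>
             (\<exists>c::real. \<forall>i\<in>I. u (x i, y i) \<le> ereal c)"
  then have I: "directed_set I le" and cx: "net_converges I le x l"
    and yx: "\<And>i. i \<in> I \<Longrightarrow> y i \<in> \<Phi> (x i)"
    by auto
  obtain c :: real where c: "\<And>i. i \<in> I \<Longrightarrow> u (x i, y i) \<le> ereal c"
    using A by auto
  define tail where "tail = (\<lambda>i. (\<lambda>j. (x j, y j)) ` {j \<in> I. le i j})"
  define I' where "I' = {(T, p). \<exists>i\<in>I. T = tail i \<and> p \<in> T}"
  define le' :: "('x \<times> 'y) set \<times> ('x \<times> 'y) \<Rightarrow> ('x \<times> 'y) set \<times> ('x \<times> 'y) \<Rightarrow> bool"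
    where "le' = (\<lambda>a b. fst b \<subseteq> fst a)"
  have refl: "\<And>i. i \<in> I \<Longrightarrow> le i i"
    using I by (simp add: directed_set_def reflp_on_def)
  have trans: "\<And>i j k. i \<in> I \<Longrightarrow> j \<in> I \<Longrightarrow> k \<in> I \<Longrightarrow> le i j \<Longrightarrow> le j k \<Longrightarrow> le i k"
    using I unfolding directed_set_def by (meson transp_onD)
  have tail_mono: "tail j \<subseteq> tail i" if "i \<in> I" "j \<in> I" "le i j" for i j
    unfolding tail_def using trans[OF that(1,2) _ that(3)] by blast
  have in_I': "(tail i, (x i, y i)) \<in> I'" if "i \<in> I" for i
    using that refl[OF that] by (auto simp: I'_def tail_def)
  have I'_D: "\<exists>i\<in>I. snd a = (x i, y i)" if "a \<in> I'" for a
    using that by (auto simp: I'_def tail_def)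
  have dir: "directed_set I' le'"
    unfolding directed_set_def
  proof (intro conjI ballI)
    show "I' \<noteq> {}" using I in_I' unfolding directed_set_def by blast
    show "reflp_on I' le'" by (simp add: reflp_on_def le'_def)
    show "transp_on I' le'" by (rule transp_onI) (auto simp: le'_def)
  next
    fix a b assume "a \<in> I'" "b \<in> I'"
    then obtain i j where ij: "i \<in> I" "j \<in> I" "fst a = tail i" "fst b = tail j"
      by (auto simp: I'_def)
    then obtain k where k: "k \<in> I" "le i k" "le j k"
      using I ij(1,2) unfolding directed_set_def by meson
    then show "\<exists>c\<in>I'. le' a c \<and> le' b c"
      using ij tail_mono[of i k] tail_mono[of j k] in_I'[OF k(1)]
      by (intro bexI[of _ "(tail k, (x k, y k))"]) (auto simp: le'_def)
  qed
  have conv: "net_converges I' le' (\<lambda>a. fst (snd a)) l"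
    unfolding net_converges_def
  proof (intro allI impI)
    fix U assume "open U \<and> l \<in> U"
    then obtain i where i: "i \<in> I" "\<And>j. j \<in> I \<Longrightarrow> le i j \<Longrightarrow> x j \<in> U"
      using cx unfolding net_converges_def by meson
    have "fst (snd b) \<in> U" if "b \<in> I'" "fst b \<subseteq> tail i" for b
    proof -
      have "snd b \<in> tail i" using that by (auto simp: I'_def)
      then show ?thesis using i by (auto simp: tail_def)
    qed
    then show "\<exists>a\<in>I'. \<forall>b\<in>I'. le' a b \<longrightarrow> fst (snd b) \<in> U"
      using in_I'[OF i(1)] by (intro bexI[of _ "(tail i, (x i, y i))"]) (auto simp: le'_def)
  qed
  have mem: "\<forall>a\<in>I'. snd (snd a) \<in> \<Phi> (fst (snd a))"
  proof
    fix a assume "a \<in> I'"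
    then obtain i where "i \<in> I" "snd a = (x i, y i)" using I'_D by blast
    then show "snd (snd a) \<in> \<Phi> (fst (snd a))" using yx by simp
  qed
  have bdd: "\<exists>c::real. \<forall>a\<in>I'. u (fst (snd a), snd (snd a)) \<le> ereal c"
  proof (intro exI ballI)
    fix a assume "a \<in> I'"
    then obtain i where "i \<in> I" "snd a = (x i, y i)" using I'_D by blast
    then show "u (fst (snd a), snd (snd a)) \<le> ereal c" using c by simp
  qed
  obtain z where z: "z \<in> \<Phi> l" "net_accumulation_point I' le' (\<lambda>a. snd (snd a)) z"
    using assms[unfolded KN_inf_compact_def KN_net_condition_def, THEN conjunct2, THEN spec[of _ I'],
        THEN spec[of _ le'], THEN spec[of _ "\<lambda>a. fst (snd a)"],
        THEN spec[of _ "\<lambda>a. snd (snd a)"], THEN spec[of _ l]] dir conv mem bdd by blast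
  have "\<exists>j\<in>I. le i j \<and> y j \<in> U" if U: "open U" "z \<in> U" and i: "i \<in> I" for U i
  proof -
    obtain b where b: "b \<in> I'" "fst b \<subseteq> tail i" "snd (snd b) \<in> U"
      using z(2)[unfolded net_accumulation_point_iff[OF dir], rule_format, OF conjI[OF U] in_I'[OF i]]
      by (auto simp: le'_def)
    then have "snd b \<in> tail i" by (auto simp: I'_def)
    then show ?thesis using b(3) by (auto simp: tail_def)
  qed
  then have "net_accumulation_point I le y z"
    by (simp add: net_accumulation_point_iff[OF I])
  with z(1) show "\<exists>z\<in>\<Phi> l. net_accumulation_point I le y z" by blast
qed

end

theory Submission
  imports Defs
begin

text \<open>
  Write \<open>D\<^sub>c\<close> for the sublevel set \<open>{(x, y). y \<in> \<Phi> x \<and> u (x, y) \<le> c}\<close> and consider its projection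
  to \<open>'x\<close>. For Hausdorff spaces with \<open>'x\<close> a k-space, both conditions amount to these projections being
  proper maps, that is, closed with compact fibres.

  \<open>K_inf_compact\<close> says that preimages of compact sets under the projection \<open>D\<^sub>c \<rightarrow> 'x\<close> are compact.
  If \<open>'x\<close> is a Hausdorff k-space, this makes the projection a closed map: for \<open>F\<close> relatively closed
  in \<open>D\<^sub>c\<close>, the image of \<open>F\<close> meets each compact \<open>K\<close> in the image of a compact set. A closed map has a
  tube property (\<open>fibre_tube\<close>): an open set \<open>W\<close> that contains the fibre over \<open>x\<close> contains all fibres
  over a neighbourhood of \<open>x\<close>. Two consequences follow. Separating a point from a compact fibre in
  the Hausdorff space \<open>'y\<close> shows that \<open>D\<^sub>c\<close> is closed, so \<open>u\<close> is lower semicontinuous. And a net in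
  \<open>D\<^sub>c\<close> over a convergent net must accumulate at a point of the limit fibre: otherwise finitely many
  open sets that the net eventually avoids cover this fibre, while by the tube property the net
  eventually lies in their union.

  Conversely, a filter on the part of \<open>D\<^sub>c\<close> over a compact \<open>K\<close> has a refinement whose first coordinate
  converges in \<open>K\<close>. The net condition, applied to the net of pointed members of this filter, gives a
  cluster point (\<open>KN_net_condition_imp_cluster_point\<close>), and lower semicontinuity puts it in \<open>D\<^sub>c\<close>.
\<close>

section \<open>Relations that are compact over compact sets\<close>

text \<open>A k-space tests closedness on compact sets, and over a compact set the projection has compact,
  hence closed, images of closed sets.\<close>

lemma closed_projection_over_k_space:
  fixes D :: "('x::t2_space \<times> 'y::topological_space) set"
  assumes k: "k_space (euclidean :: 'x topology)"
    and D: "\<And>K. compact K \<Longrightarrow> compact (D \<inter> K \<times> UNIV)"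
    and C: "closed C"
  shows "closed (fst ` (D \<inter> C))"
proof -
  have "closedin (top_of_set K) (fst ` (D \<inter> C) \<inter> K)" if K: "compact K" for K
  proof -
    have "compact (fst ` (D \<inter> K \<times> UNIV \<inter> C))"
      using compact_Int_closed[OF D[OF K] C] by (intro compact_continuous_image continuous_intros)
    moreover have "fst ` (D \<inter> K \<times> UNIV \<inter> C) = fst ` (D \<inter> C) \<inter> K"
      by force
    ultimately have "closed (fst ` (D \<inter> C) \<inter> K)"
      by (simp add: compact_imp_closed)
    then show ?thesis
      by (simp add: closed_subset)
  qed
  then show ?thesis
    using k unfolding k_space_euclidean_iff by blast
qed

text \<open>The base points whose fibre leaves \<open>W\<close> are the projection of the part of \<open>D\<close> outside
  \<open>UNIV \<times> W\<close>, so they form a closed set.\<close>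

lemma fibre_tube:
  fixes D :: "('x::t2_space \<times> 'y::topological_space) set"
  assumes k: "k_space (euclidean :: 'x topology)"
    and D: "\<And>K. compact K \<Longrightarrow> compact (D \<inter> K \<times> UNIV)"
    and W: "open W" "D `` {x} \<subseteq> W"
  obtains U where "open U" "x \<in> U" "D `` U \<subseteq> W"
proof
  let ?B = "fst ` (D \<inter> UNIV \<times> (- W))"
  have "closed ?B"
    using W(1) by (intro closed_projection_over_k_space[OF k D] closed_Times) auto
  then show "open (- ?B)"
    by (simp add: open_Compl)
  show "x \<in> - ?B" "D `` (- ?B) \<subseteq> W"
    using W(2) by force+
qed

lemma compact_fibre:
  fixes D :: "('x::topological_space \<times> 'y::topological_space) set"
  assumes "\<And>K. compact K \<Longrightarrow> compact (D \<inter> K \<times> UNIV)"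
  shows "compact (D `` {x})"
proof -
  have "compact (snd ` (D \<inter> {x} \<times> UNIV))"
    using assms[of "{x}"] by (intro compact_continuous_image continuous_intros) auto
  moreover have "snd ` (D \<inter> {x} \<times> UNIV) = D `` {x}"
    by force
  ultimately show ?thesis
    by simp
qed

text \<open>A point outside \<open>D\<close> is separated from the compact fibre over its first coordinate by disjoint
  open sets; the tube property carries the separation over to all nearby fibres.\<close>

lemma closed_if_compact_over_compacts:
  fixes D :: "('x::t2_space \<times> 'y::t2_space) set"
  assumes k: "k_space (euclidean :: 'x topology)"
    and D: "\<And>K. compact K \<Longrightarrow> compact (D \<inter> K \<times> UNIV)"
  shows "closed D"
proof -
  have "\<exists>T. open T \<and> p \<in> T \<and> T \<subseteq> - D" if "p \<in> - D" for p
  proof -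
    obtain x y where p: "p = (x, y)"
      by fastforce
    have "y \<notin> D `` {x}"
      using that p by auto
    then have "disjnt {y} (D `` {x})"
      by (simp add: disjnt_def)
    moreover have "Hausdorff_space (euclidean :: 'y topology)"
      unfolding Hausdorff_space_def by (simp add: disjnt_def) (metis hausdorff)
    moreover have "compact (D `` {x})"
      using D by (rule compact_fibre)
    ultimately obtain V W where
      VW: "open V" "open W" "{y} \<subseteq> V" "D `` {x} \<subseteq> W" "disjnt V W"
      using Hausdorff_space_compact_separation[of euclidean "{y}" "D `` {x}"]
      by (metis compactin_euclidean_iff finite.emptyI finite_imp_compact finite_insert open_openin)
    obtain U where "open U" "x \<in> U" "D `` U \<subseteq> W"
      using fibre_tube[OF k D VW(2,4)] .
    then have "open (U \<times> V) \<and> p \<in> U \<times> V \<and> U \<times> V \<subseteq> - D"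
      using VW p by (auto simp: open_Times disjnt_iff)
    then show ?thesis
      by blast
  qed
  then have "open (- D)"
    using open_subopen[of "- D"] by blast
  then show ?thesis
    by (simp add: closed_def)
qed

section \<open>Nets over a convergent net\<close>

lemma directed_set_finite_upper_bound:
  assumes I: "directed_set I le" and "finite A" "A \<subseteq> I"
  obtains k where "k \<in> I" "\<And>i. i \<in> A \<Longrightarrow> le i k"
proof -
  have "\<exists>k\<in>I. \<forall>i\<in>A. le i k"
    using \<open>finite A\<close> \<open>A \<subseteq> I\<close>
  proof (induction A rule: finite_induct)
    case empty
    then show ?case
      using I by (auto simp: directed_set_def)
  next
    case (insert a A)
    then obtain k m where km: "k \<in> I" "\<And>i. i \<in> A \<Longrightarrow> le i k" "m \<in> I" "le k m" "le a m"
      using I unfolding directed_set_def by (metis insert_subset)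
    then have "le i m" if "i \<in> A" for i
      using I insert.prems that unfolding directed_set_def by (meson insert_subset subsetD transp_onD)
    with km show ?case
      by blast
  qed
  with that show ?thesis
    by blast
qed

text \<open>Suppose that every point of the fibre over the limit has a neighbourhood that the net eventually
  avoids. Finitely many of them cover the fibre, and by the tube property their union contains
  \<open>y m\<close> for all large \<open>m\<close>, so one of them is not avoided.\<close>

lemma net_accumulates_in_compact_fibre:
  fixes D :: "('x::t2_space \<times> 'y::topological_space) set"
  assumes k: "k_space (euclidean :: 'x topology)"
    and D: "\<And>K. compact K \<Longrightarrow> compact (D \<inter> K \<times> UNIV)"
    and I: "directed_set I le" and x: "net_converges I le x l"
    and xy: "\<And>i. i \<in> I \<Longrightarrow> (x i, y i) \<in> D"
  shows "\<exists>z. (l, z) \<in> D \<and> net_accumulation_point I le y z"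
proof (rule ccontr)
  assume "\<not> ?thesis"
  then have "\<exists>V i. open V \<and> z \<in> V \<and> i \<in> I \<and> (\<forall>j\<in>I. le i j \<longrightarrow> y j \<notin> V)"
    if "z \<in> D `` {l}" for z
    using that unfolding net_accumulation_point_iff[OF I] by simp metis
  then obtain V a where Va: "\<And>z. z \<in> D `` {l} \<Longrightarrow>
      open (V z) \<and> z \<in> V z \<and> a z \<in> I \<and> (\<forall>j\<in>I. le (a z) j \<longrightarrow> y j \<notin> V z)"
    by metis
  then have V: "\<And>z. z \<in> D `` {l} \<Longrightarrow> open (V z) \<and> z \<in> V z"
    and a: "\<And>z. z \<in> D `` {l} \<Longrightarrow> a z \<in> I"
    and avoid: "\<And>z j. z \<in> D `` {l} \<Longrightarrow> j \<in> I \<Longrightarrow> le (a z) j \<Longrightarrow> y j \<notin> V z"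
    by blast+
  have "compact (D `` {l})"
    using D by (rule compact_fibre)
  moreover have "D `` {l} \<subseteq> (\<Union>z\<in>D `` {l}. V z)"
    using V by blast
  moreover have "\<And>z. z \<in> D `` {l} \<Longrightarrow> open (V z)"
    using V by blast
  ultimately obtain Z where Z: "Z \<subseteq> D `` {l}" "finite Z" "D `` {l} \<subseteq> (\<Union>z\<in>Z. V z)"
    using compactE_image[of "D `` {l}" "D `` {l}" V] by metis
  have cover_open: "open (\<Union>z\<in>Z. V z)"
    using V Z(1) by blast
  obtain U where U: "open U" "l \<in> U" "D `` U \<subseteq> (\<Union>z\<in>Z. V z)"
    using fibre_tube[OF k D cover_open Z(3)] .
  obtain b where b: "b \<in> I" "\<And>j. j \<in> I \<Longrightarrow> le b j \<Longrightarrow> x j \<in> U"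
    using x U unfolding net_converges_def by meson
  obtain m where m: "m \<in> I" "\<And>i. i \<in> insert b (a ` Z) \<Longrightarrow> le i m"
  proof (rule directed_set_finite_upper_bound[OF I])
    show "finite (insert b (a ` Z))" "insert b (a ` Z) \<subseteq> I"
      using Z a b(1) by auto
  qed blast
  have "y m \<in> D `` U"
    using xy[OF m(1)] b(2) m by blast
  then obtain z where "z \<in> Z" "y m \<in> V z"
    using U(3) by blast
  then show False
    using avoid[of z m] m Z(1) by blast
qed

section \<open>Cluster points of filters from the net condition\<close>

text \<open>The pairs \<open>(S, p)\<close> with \<open>p \<in> S\<close> and \<open>S\<close> a member of the filter \<open>F\<close>, ordered by reverse
  inclusion of the sets, index a net \<open>(S, p) \<mapsto> p\<close> that generates \<open>F\<close>. The members are taken inside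
  the sublevel set, so that the net condition applies to this net.\<close>

lemma KN_net_condition_imp_cluster_point:
  fixes \<Phi> :: "'x::topological_space \<Rightarrow> 'y::topological_space set"
  assumes KN: "KN_net_condition TYPE(('x \<times> 'y) set \<times> ('x \<times> 'y)) \<Phi> u"
    and F: "F \<noteq> bot" and D: "eventually (\<lambda>p. p \<in> sublevel_set u c (Gr UNIV \<Phi>)) F"
    and lim: "filterlim fst (nhds x) F"
  shows "\<exists>z\<in>\<Phi> x. inf (nhds (x, z)) F \<noteq> bot"
proof -
  let ?D = "sublevel_set u c (Gr UNIV \<Phi>)"
  define M where "M = {S. eventually (\<lambda>p. p \<in> S) F \<and> S \<subseteq> ?D}"
  define I where "I = {(S, p). S \<in> M \<and> p \<in> S}"
  define le :: "('x \<times> 'y) set \<times> ('x \<times> 'y) \<Rightarrow> ('x \<times> 'y) set \<times> ('x \<times> 'y) \<Rightarrow> bool"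
    where "le = (\<lambda>a b. fst b \<subseteq> fst a)"
  have M_ne: "\<exists>p. p \<in> S" if "S \<in> M" for S
    using that F eventually_happens'[of F "\<lambda>p. p \<in> S"] by (auto simp: M_def)
  have M_Int: "{p \<in> S. P p} \<in> M" if "S \<in> M" "eventually P F" for S P
    using that by (auto simp: M_def eventually_conj)
  have D_M: "?D \<in> M"
    using D by (simp add: M_def)
  have dir: "directed_set I le"
    unfolding directed_set_def
  proof (intro conjI ballI)
    show "I \<noteq> {}"
      using D_M M_ne by (auto simp: I_def)
    show "reflp_on I le"
      by (simp add: reflp_on_def le_def)
    show "transp_on I le"
      by (rule transp_onI) (auto simp: le_def)
  next
    fix a b assume "a \<in> I" "b \<in> I"
    then have "fst a \<inter> fst b \<in> M"
      by (auto simp: I_def M_def eventually_conj)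
    then obtain p where "(fst a \<inter> fst b, p) \<in> I"
      using M_ne by (force simp: I_def)
    then show "\<exists>d\<in>I. le a d \<and> le b d"
      by (intro bexI[of _ "(fst a \<inter> fst b, p)"]) (auto simp: le_def)
  qed
  have conv: "net_converges I le (\<lambda>a. fst (snd a)) x"
    unfolding net_converges_def
  proof (intro allI impI)
    fix U assume "open U \<and> x \<in> U"
    then have S: "{p \<in> ?D. fst p \<in> U} \<in> M" (is "?S \<in> M")
      using lim by (intro M_Int D_M) (auto dest: topological_tendstoD)
    then obtain p where "(?S, p) \<in> I"
      using M_ne by (force simp: I_def)
    then show "\<exists>i\<in>I. \<forall>j\<in>I. le i j \<longrightarrow> fst (snd j) \<in> U"
      by (rule bexI[rotated]) (auto simp: I_def le_def)
  qed
  have mem: "snd a \<in> ?D" if "a \<in> I" for a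
    using that by (auto simp: I_def M_def)
  have graph: "\<forall>a\<in>I. snd (snd a) \<in> \<Phi> (fst (snd a))"
    using mem by (force simp: sublevel_set_def)
  have bdd: "\<exists>c::real. \<forall>a\<in>I. u (fst (snd a), snd (snd a)) \<le> ereal c"
    using mem by (intro exI[of _ c]) (auto simp: sublevel_set_def)
  obtain z where z: "z \<in> \<Phi> x" "net_accumulation_point I le (\<lambda>a. snd (snd a)) z"
    using KN[unfolded KN_net_condition_def, THEN spec[of _ I], THEN spec[of _ le],
        THEN spec[of _ "\<lambda>a. fst (snd a)"], THEN spec[of _ "\<lambda>a. snd (snd a)"], THEN spec[of _ x]]
      dir conv graph bdd by blast
  have "\<exists>p. P p \<and> Q p" if P: "eventually P (nhds (x, z))" and Q: "eventually Q F" for P Q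
  proof -
    obtain T where T: "open T" "(x, z) \<in> T" "\<And>p. p \<in> T \<Longrightarrow> P p"
      using P unfolding eventually_nhds by blast
    then obtain U V where UV: "open U" "open V" "(x, z) \<in> U \<times> V" "U \<times> V \<subseteq> T"
      using open_prod_elim by metis
    let ?S = "{p \<in> {p \<in> ?D. Q p}. fst p \<in> U}"
    have "?S \<in> M"
      using lim Q UV by (intro M_Int D_M) (auto dest: topological_tendstoD)
    then obtain p where p: "(?S, p) \<in> I"
      using M_ne by (force simp: I_def)
    obtain j where j: "j \<in> I" "le (?S, p) j" "snd (snd j) \<in> V"
      using z(2)[unfolded net_accumulation_point_iff[OF dir], rule_format, OF _ p, of V] UV by auto
    then have "snd j \<in> ?S"
      by (auto simp: I_def le_def)
    with j(3) UV T(3) show ?thesis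
      by (intro exI[of _ "snd j"]) (force simp: mem_Times_iff)
  qed
  then have "inf (nhds (x, z)) F \<noteq> bot"
    unfolding trivial_limit_def eventually_inf by blast
  with z(1) show ?thesis
    by blast
qed

section \<open>Compact sublevel sets and the net condition\<close>

lemma sublevel_set_Gr_Int:
  "sublevel_set u c (Gr UNIV \<Phi>) \<inter> K \<times> UNIV = sublevel_set u c (Gr K \<Phi>)"
  by (auto simp: sublevel_set_def)

lemma K_inf_compact_imp_compact_over_compacts:
  assumes "K_inf_compact \<Phi> u" "compact K"
  shows "compact (sublevel_set u c (Gr UNIV \<Phi>) \<inter> K \<times> UNIV)"
  using assms by (cases "K = {}") (auto simp: sublevel_set_Gr_Int K_inf_compact_def inf_compact_on_def)

lemma K_inf_compact_imp_KN_inf_compact: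
  fixes \<Phi> :: "'x::t2_space \<Rightarrow> 'y::t2_space set"
  assumes k: "k_space (euclidean :: 'x topology)" and K: "K_inf_compact \<Phi> u"
  shows "KN_inf_compact \<Phi> u"
  unfolding KN_inf_compact_def KN_net_condition_def
proof (intro conjI allI impI)
  note D = K_inf_compact_imp_compact_over_compacts[OF K]
  show "lower_semicontinuous_on (Gr UNIV \<Phi>) u"
    unfolding lower_semicontinuous_on_def
    using closed_if_compact_over_compacts[OF k D]
    by (intro allI closed_subset) (auto simp: sublevel_set_def)
  fix I :: "(('x \<times> 'y) set \<times> ('x \<times> 'y)) set" and le x y l
  assume A: "directed_set I le \<and> net_converges I le x l \<and> (\<forall>i\<in>I. y i \<in> \<Phi> (x i)) \<and>
      (\<exists>c::real. \<forall>i\<in>I. u (x i, y i) \<le> ereal c)"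
  then obtain c :: real where "\<And>i. i \<in> I \<Longrightarrow> (x i, y i) \<in> sublevel_set u c (Gr UNIV \<Phi>)"
    by (auto simp: sublevel_set_def)
  then obtain z where "(l, z) \<in> sublevel_set u c (Gr UNIV \<Phi>)" "net_accumulation_point I le y z"
    using net_accumulates_in_compact_fibre[OF k D, of I le x l y] A by blast
  then show "\<exists>z\<in>\<Phi> l. net_accumulation_point I le y z"
    by (auto simp: sublevel_set_def)
qed

lemma KN_inf_compact_imp_K_inf_compact:
  fixes \<Phi> :: "'x::topological_space \<Rightarrow> 'y::topological_space set"
  assumes KN: "KN_inf_compact \<Phi> u"
  shows "K_inf_compact \<Phi> u"
  unfolding K_inf_compact_def inf_compact_on_def
proof (intro allI impI)
  fix K :: "'x set" and c
  assume "compact K \<and> K \<noteq> {}"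
  then have K: "compact K"
    by simp
  let ?D = "sublevel_set u c (Gr UNIV \<Phi>)"
  obtain C where C: "closed C" "?D = Gr UNIV \<Phi> \<inter> C"
    using KN unfolding KN_inf_compact_def lower_semicontinuous_on_def closedin_closed by blast
  show "compact (sublevel_set u c (Gr K \<Phi>))"
    unfolding compact_filter
  proof (intro allI impI)
    fix F :: "('x \<times> 'y) filter"
    assume F: "F \<noteq> bot" and ev: "eventually (\<lambda>p. p \<in> sublevel_set u c (Gr K \<Phi>)) F"
    have "eventually (\<lambda>x. x \<in> K) (filtermap fst F)"
      using ev unfolding eventually_filtermap by eventually_elim (auto simp: sublevel_set_def)
    then obtain x where x: "x \<in> K" "inf (nhds x) (filtermap fst F) \<noteq> bot"
      using K F unfolding compact_filter by (metis filtermap_bot_iff)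
    \<comment> \<open>\<open>F\<close> only clusters over \<open>x\<close>, but the net condition needs convergence of the first coordinate,
      so \<open>F\<close> is refined by the preimages of the neighbourhoods of \<open>x\<close>.\<close>
    define G where "G = inf F (filtercomap fst (nhds x))"
    have G: "G \<noteq> bot"
    proof
      assume "G = bot"
      then obtain P Q where P: "eventually P F" and Q: "eventually Q (filtercomap fst (nhds x))"
        and PQ: "\<And>p. P p \<Longrightarrow> Q p \<Longrightarrow> False"
        unfolding G_def trivial_limit_def eventually_inf by blast
      obtain R where R: "eventually R (nhds x)" "\<And>p. R (fst p) \<Longrightarrow> Q p"
        using Q unfolding eventually_filtercomap by blast
      have "eventually (\<lambda>a. \<not> R a) (filtermap fst F)"
        unfolding eventually_filtermap using P by eventually_elim (use PQ R(2) in blast)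
      then show False
        using x(2) R(1) unfolding trivial_limit_def eventually_inf by blast
    qed
    have "G \<le> F"
      by (simp add: G_def)
    have "eventually (\<lambda>p. p \<in> ?D) F"
      using ev by eventually_elim (auto simp: sublevel_set_def)
    then have evG: "eventually (\<lambda>p. p \<in> ?D) G"
      using \<open>G \<le> F\<close> by (simp add: filter_leD)
    have "filterlim fst (nhds x) G"
      by (simp add: G_def filterlim_iff_le_filtercomap)
    then obtain z where z: "z \<in> \<Phi> x" "inf (nhds (x, z)) G \<noteq> bot"
      using KN_net_condition_imp_cluster_point[OF _ G evG] KN unfolding KN_inf_compact_def by blast
    \<comment> \<open>The cluster point lies on the graph, where the sublevel set is relatively closed.\<close>
    have "(x, z) \<in> C"
    proof (rule ccontr)
      assume "(x, z) \<notin> C"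
      then have "eventually (\<lambda>p. p \<in> - C) (nhds (x, z))"
        using C(1) by (intro eventually_nhds_in_open) auto
      then show False
        using z(2) evG C(2) unfolding trivial_limit_def eventually_inf by blast
    qed
    then have "(x, z) \<in> ?D"
      using C(2) z(1) by auto
    then have "(x, z) \<in> sublevel_set u c (Gr K \<Phi>)"
      using x(1) by (auto simp: sublevel_set_def)
    moreover have "inf (nhds (x, z)) F \<noteq> bot"
      using z(2) \<open>G \<le> F\<close> by (metis bot.extremum_uniqueI inf_mono order_refl)
    ultimately show "\<exists>p\<in>sublevel_set u c (Gr K \<Phi>). inf (nhds p) F \<noteq> bot"
      by blast
  qed
qed

theorem corollary2p2:
  fixes \<Phi> :: "'x::t2_space \<Rightarrow> 'y::t2_space set"
    and u :: "'x \<times> 'y \<Rightarrow> ereal"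
  assumes "\<And>x. \<Phi> x \<noteq> {}"
    and "k_space (euclidean :: 'x topology)"
  shows "KN_inf_compact \<Phi> u \<longleftrightarrow> K_inf_compact \<Phi> u"
  using KN_inf_compact_imp_K_inf_compact K_inf_compact_imp_KN_inf_compact[OF assms(2)] by blast

end
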